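(* Let $m\ge 1$ be an integer and let $H(m)$ be the Heisenberg Lie algebra of dimension $2m+1$ over a field. Then $H(m)$ is capable if and only if $m=1$.
   Context: All Lie algebras are finite dimensional over a fixed field. A Lie algebra $L$ is called capable if there exists a Lie algebra $E$ such that $L\cong E/Z(E)$, where $Z(E)$ is the center of $E$. The Heisenberg Lie algebra $H(m)$ has basis $x_1,\dots,x_m,y_1,\dots,y_m,z$ with $[x_i,y_i]=z$ for $1\le i\le m$ and all other brackets of basis elements (apart from those forced by antisymmetry) equal to zero. *)

theory Defs
  imports "HOL-Algebra.Module" "HOL-Algebra.QuotRing"
begin

section \<open>Lie algebras\<close>

text \<open>
  A Lie algebra is carried by the record type \<open>module\<close> of HOL-Algebra; its ring multiplication
  \<open>x \<otimes>\<^bsub>L\<^esub> y\<close> is the Lie bracket \<open>[x, y]\<close>.  The field \<open>one\<close> of the record plays no role.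
\<close>

locale lie_algebra = K?: field K + L?: module K L
  for K :: "('a, 'b) ring_scheme" (structure) and L :: "('a, 'v, 'c) module_scheme" (structure) +
  assumes bracket_closed:
      "\<lbrakk>x \<in> carrier L; y \<in> carrier L\<rbrakk> \<Longrightarrow> x \<otimes>\<^bsub>L\<^esub> y \<in> carrier L"
    and bracket_add_left:
      "\<lbrakk>x \<in> carrier L; y \<in> carrier L; z \<in> carrier L\<rbrakk> \<Longrightarrow>
        (x \<oplus>\<^bsub>L\<^esub> y) \<otimes>\<^bsub>L\<^esub> z = x \<otimes>\<^bsub>L\<^esub> z \<oplus>\<^bsub>L\<^esub> y \<otimes>\<^bsub>L\<^esub> z"
    and bracket_add_right:
      "\<lbrakk>x \<in> carrier L; y \<in> carrier L; z \<in> carrier L\<rbrakk> \<Longrightarrow>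
        x \<otimes>\<^bsub>L\<^esub> (y \<oplus>\<^bsub>L\<^esub> z) = x \<otimes>\<^bsub>L\<^esub> y \<oplus>\<^bsub>L\<^esub> x \<otimes>\<^bsub>L\<^esub> z"
    and bracket_smult_left:
      "\<lbrakk>a \<in> carrier K; x \<in> carrier L; y \<in> carrier L\<rbrakk> \<Longrightarrow>
        (a \<odot>\<^bsub>L\<^esub> x) \<otimes>\<^bsub>L\<^esub> y = a \<odot>\<^bsub>L\<^esub> (x \<otimes>\<^bsub>L\<^esub> y)"
    and bracket_smult_right:
      "\<lbrakk>a \<in> carrier K; x \<in> carrier L; y \<in> carrier L\<rbrakk> \<Longrightarrow>
        x \<otimes>\<^bsub>L\<^esub> (a \<odot>\<^bsub>L\<^esub> y) = a \<odot>\<^bsub>L\<^esub> (x \<otimes>\<^bsub>L\<^esub> y)"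
    and bracket_self: "x \<in> carrier L \<Longrightarrow> x \<otimes>\<^bsub>L\<^esub> x = \<zero>\<^bsub>L\<^esub>"
    and jacobi:
      "\<lbrakk>x \<in> carrier L; y \<in> carrier L; z \<in> carrier L\<rbrakk> \<Longrightarrow>
        x \<otimes>\<^bsub>L\<^esub> (y \<otimes>\<^bsub>L\<^esub> z) \<oplus>\<^bsub>L\<^esub> y \<otimes>\<^bsub>L\<^esub> (z \<otimes>\<^bsub>L\<^esub> x) \<oplus>\<^bsub>L\<^esub> z \<otimes>\<^bsub>L\<^esub> (x \<otimes>\<^bsub>L\<^esub> y) = \<zero>\<^bsub>L\<^esub>"

definition fin_dim :: "('a, 'b) ring_scheme \<Rightarrow> ('a, 'v, 'c) module_scheme \<Rightarrow> bool" where
  "fin_dim K V \<longleftrightarrow>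
    (\<exists>(n::nat) b. b \<in> {..<n} \<rightarrow> carrier V \<and>
      (\<forall>v \<in> carrier V. \<exists>c \<in> {..<n} \<rightarrow> carrier K. v = (\<Oplus>\<^bsub>V\<^esub>i\<in>{..<n}. c i \<odot>\<^bsub>V\<^esub> b i)))"

definition lie_center :: "('a, 'v, 'c) module_scheme \<Rightarrow> 'v set" where
  "lie_center L = {x \<in> carrier L. \<forall>y \<in> carrier L. x \<otimes>\<^bsub>L\<^esub> y = \<zero>\<^bsub>L\<^esub>}"

text \<open>
  The quotient by an ideal, on the same pattern as \<^const>\<open>FactRing\<close>: for cosets,
  \<open>a \<odot> (I +> x) = I +> (a \<odot> x)\<close> and \<open>(I +> x) \<otimes> (I +> y) = I +> (x \<otimes> y)\<close>.
\<close>

definition lie_quotient ::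
  "('a, 'v, 'c) module_scheme \<Rightarrow> 'v set \<Rightarrow> ('a, 'v set) module" where
  "lie_quotient L I =
    \<lparr>carrier = a_rcosets\<^bsub>L\<^esub> I, mult = rcoset_mult L I, one = I +>\<^bsub>L\<^esub> \<one>\<^bsub>L\<^esub>,
     zero = I, add = set_add L, smult = (\<lambda>a X. \<Union>x\<in>X. I +>\<^bsub>L\<^esub> (a \<odot>\<^bsub>L\<^esub> x))\<rparr>"

definition lie_iso ::
  "('a, 'b) ring_scheme \<Rightarrow> ('a, 'v, 'c) module_scheme \<Rightarrow> ('a, 'w, 'd) module_scheme \<Rightarrow> ('v \<Rightarrow> 'w) set"
  where
  "lie_iso K L M = {h. bij_betw h (carrier L) (carrier M) \<and>
    (\<forall>x \<in> carrier L. \<forall>y \<in> carrier L. h (x \<oplus>\<^bsub>L\<^esub> y) = h x \<oplus>\<^bsub>M\<^esub> h y) \<and>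
    (\<forall>a \<in> carrier K. \<forall>x \<in> carrier L. h (a \<odot>\<^bsub>L\<^esub> x) = a \<odot>\<^bsub>M\<^esub> h x) \<and>
    (\<forall>x \<in> carrier L. \<forall>y \<in> carrier L. h (x \<otimes>\<^bsub>L\<^esub> y) = h x \<otimes>\<^bsub>M\<^esub> h y)}"

definition lie_isomorphic ::
  "('a, 'b) ring_scheme \<Rightarrow> ('a, 'v, 'c) module_scheme \<Rightarrow> ('a, 'w, 'd) module_scheme \<Rightarrow> bool" where
  "lie_isomorphic K L M \<longleftrightarrow> lie_iso K L M \<noteq> {}"

text \<open>
  HOL cannot quantify existentially over types, so the underlying set of \<open>E\<close> is taken inside the
  type of sequences of scalars.  This loses nothing: \<open>capableI\<close> below allows \<open>E\<close> to live in any
  type whatsoever.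
\<close>

definition capable :: "('a, 'b) ring_scheme \<Rightarrow> ('a, 'v, 'c) module_scheme \<Rightarrow> bool" where
  "capable K L \<longleftrightarrow>
    (\<exists>E :: ('a, nat \<Rightarrow> 'a) module.
      lie_algebra K E \<and> fin_dim K E \<and> lie_isomorphic K L (lie_quotient E (lie_center E)))"


section \<open>Independence of the carrier type\<close>

definition transport ::
  "('v \<Rightarrow> 'w) \<Rightarrow> ('a, 'v, 'c) module_scheme \<Rightarrow> ('a, 'w) module" where
  "transport f E = (let g = inv_into (carrier E) f in
    \<lparr>carrier = f ` carrier E, mult = (\<lambda>u v. f (g u \<otimes>\<^bsub>E\<^esub> g v)), one = f \<one>\<^bsub>E\<^esub>,
     zero = f \<zero>\<^bsub>E\<^esub>, add = (\<lambda>u v. f (g u \<oplus>\<^bsub>E\<^esub> g v)), smult = (\<lambda>a u. f (a \<odot>\<^bsub>E\<^esub> g u))\<rparr>)"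

lemma transport_simps:
  assumes "inj_on f (carrier E)"
  shows "carrier (transport f E) = f ` carrier E"
    and "\<zero>\<^bsub>transport f E\<^esub> = f \<zero>\<^bsub>E\<^esub>"
    and "\<one>\<^bsub>transport f E\<^esub> = f \<one>\<^bsub>E\<^esub>"
    and "\<lbrakk>x \<in> carrier E; y \<in> carrier E\<rbrakk> \<Longrightarrow> f x \<otimes>\<^bsub>transport f E\<^esub> f y = f (x \<otimes>\<^bsub>E\<^esub> y)"
    and "\<lbrakk>x \<in> carrier E; y \<in> carrier E\<rbrakk> \<Longrightarrow> f x \<oplus>\<^bsub>transport f E\<^esub> f y = f (x \<oplus>\<^bsub>E\<^esub> y)"
    and "x \<in> carrier E \<Longrightarrow> a \<odot>\<^bsub>transport f E\<^esub> f x = f (a \<odot>\<^bsub>E\<^esub> x)"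
  using assms by (auto simp: transport_def Let_def)

lemma transport_lie_algebra:
  assumes "lie_algebra K E" and inj: "inj_on f (carrier E)"
  shows "lie_algebra K (transport f E)"
proof -
  interpret lie_algebra K E by fact
  note T = transport_simps[OF inj]
  have ag: "abelian_group (transport f E)"
  proof (rule abelian_groupI)
    fix u assume "u \<in> carrier (transport f E)"
    then obtain x where x: "u = f x" "x \<in> carrier E" by (auto simp: T)
    show "\<exists>y\<in>carrier (transport f E). y \<oplus>\<^bsub>transport f E\<^esub> u = \<zero>\<^bsub>transport f E\<^esub>"
      by (rule bexI[of _ "f (\<ominus>\<^bsub>E\<^esub> x)"]) (use x in \<open>auto simp: T L.M.l_neg\<close>)
  qed (auto simp: T L.M.a_ac)
  have "module K (transport f E)"
    by (rule moduleI[OF K.is_cring ag])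
      (auto simp: T smult_l_distr smult_r_distr smult_assoc1)
  then show ?thesis
    by (intro lie_algebra.intro K.field_axioms lie_algebra_axioms.intro)
      (auto simp: T bracket_closed bracket_add_left bracket_add_right bracket_smult_left
        bracket_smult_right bracket_self jacobi)
qed

lemma transport_finsum:
  assumes "lie_algebra K E" and inj: "inj_on f (carrier E)"
    and "finite A" "h \<in> A \<rightarrow> carrier E"
  shows "(\<Oplus>\<^bsub>transport f E\<^esub>i\<in>A. f (h i)) = f (\<Oplus>\<^bsub>E\<^esub>i\<in>A. h i)"
proof -
  interpret E: lie_algebra K E by fact
  interpret T: lie_algebra K "transport f E" by (rule transport_lie_algebra) fact+
  note T = transport_simps[OF inj]
  show ?thesis using assms(3,4)
  proof (induction rule: finite_induct)
    case empty then show ?case by (simp add: T)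
  next
    case (insert x F)
    then have "(\<lambda>i. f (h i)) \<in> F \<rightarrow> carrier (transport f E)" "h \<in> F \<rightarrow> carrier E"
      by (auto simp: T)
    with insert show ?case
      by (subst T.L.M.finsum_insert) (auto simp: T E.L.M.finsum_insert)
  qed
qed

lemma transport_fin_dim:
  assumes "lie_algebra K E" "inj_on f (carrier E)" "fin_dim K E"
  shows "fin_dim K (transport f E)"
proof -
  interpret E: lie_algebra K E by fact
  note T = transport_simps[OF assms(2)]
  obtain n :: nat and b where b: "b \<in> {..<n} \<rightarrow> carrier E"
    and span: "\<And>v. v \<in> carrier E \<Longrightarrow>
      \<exists>c \<in> {..<n} \<rightarrow> carrier K. v = (\<Oplus>\<^bsub>E\<^esub>i\<in>{..<n}. c i \<odot>\<^bsub>E\<^esub> b i)"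
    using assms(3) unfolding fin_dim_def by blast
  show ?thesis
    unfolding fin_dim_def
  proof (intro exI conjI ballI)
    show "f \<circ> b \<in> {..<n} \<rightarrow> carrier (transport f E)" using b by (auto simp: T)
    fix u assume "u \<in> carrier (transport f E)"
    then obtain v where v: "u = f v" "v \<in> carrier E" by (auto simp: T)
    then obtain c where c: "c \<in> {..<n} \<rightarrow> carrier K" "v = (\<Oplus>\<^bsub>E\<^esub>i\<in>{..<n}. c i \<odot>\<^bsub>E\<^esub> b i)"
      using span by blast
    have mem: "(\<lambda>i. c i \<odot>\<^bsub>E\<^esub> b i) \<in> {..<n} \<rightarrow> carrier E" using b c by auto
    interpret T: lie_algebra K "transport f E" by (rule transport_lie_algebra) fact+
    have "u = (\<Oplus>\<^bsub>transport f E\<^esub>i\<in>{..<n}. f (c i \<odot>\<^bsub>E\<^esub> b i))"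
      using transport_finsum[OF assms(1,2) _ mem] v c by simp
    also have "\<dots> = (\<Oplus>\<^bsub>transport f E\<^esub>i\<in>{..<n}. c i \<odot>\<^bsub>transport f E\<^esub> (f \<circ> b) i)"
      using b c mem by (intro T.L.M.finsum_cong') (auto simp: T Pi_iff)
    finally show "\<exists>c \<in> {..<n} \<rightarrow> carrier K.
        u = (\<Oplus>\<^bsub>transport f E\<^esub>i\<in>{..<n}. c i \<odot>\<^bsub>transport f E\<^esub> (f \<circ> b) i)"
      using c by blast
  qed
qed

lemma transport_center:
  assumes "lie_algebra K E" "inj_on f (carrier E)"
  shows "lie_center (transport f E) = f ` lie_center E"
proof -
  interpret E: lie_algebra K E by fact
  note T = transport_simps[OF assms(2)]
  have "f (x \<otimes>\<^bsub>E\<^esub> y) = f \<zero>\<^bsub>E\<^esub> \<longleftrightarrow> x \<otimes>\<^bsub>E\<^esub> y = \<zero>\<^bsub>E\<^esub>" if "x \<in> carrier E" "y \<in> carrier E" for x y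
    using that assms(2) E.bracket_closed by (simp add: inj_on_eq_iff)
  then show ?thesis by (auto simp: lie_center_def T)
qed

lemma transport_quotient:
  assumes "lie_algebra K E" and inj: "inj_on f (carrier E)" and I: "I \<subseteq> carrier E"
  shows "image f \<in> lie_iso K (lie_quotient E I) (lie_quotient (transport f E) (f ` I))"
proof -
  interpret E: lie_algebra K E by fact
  note T = transport_simps[OF inj]
  have coset: "f ` I +>\<^bsub>transport f E\<^esub> f x = f ` (I +>\<^bsub>E\<^esub> x)" if "x \<in> carrier E" for x
    using that I by (force simp: a_r_coset_def' T)
  have sub: "X \<subseteq> carrier E" if "X \<in> a_rcosets\<^bsub>E\<^esub> I" for X
    using that I by (auto simp: A_RCOSETS_def' a_r_coset_def')
  have car: "a_rcosets\<^bsub>transport f E\<^esub> (f ` I) = image f ` (a_rcosets\<^bsub>E\<^esub> I)"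
    unfolding A_RCOSETS_def' by (auto simp: T coset)
  have "inj_on (image f) (a_rcosets\<^bsub>E\<^esub> I)"
    using sub by (intro inj_onI) (meson inj inj_on_image_eq_iff)
  moreover have "f ` (X <+>\<^bsub>E\<^esub> Y) = f ` X <+>\<^bsub>transport f E\<^esub> f ` Y"
    if "X \<subseteq> carrier E" "Y \<subseteq> carrier E" for X Y
    unfolding set_add_def' using that
    by (simp add: image_UN) (intro SUP_cong refl; auto simp: T subset_iff)
  moreover have "f ` rcoset_mult E I X Y = rcoset_mult (transport f E) (f ` I) (f ` X) (f ` Y)"
    if "X \<subseteq> carrier E" "Y \<subseteq> carrier E" for X Y
    unfolding rcoset_mult_def using that
    by (simp add: image_UN) (intro SUP_cong refl; auto simp: T coset E.bracket_closed subset_iff)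
  moreover have "f ` (\<Union>x\<in>X. I +>\<^bsub>E\<^esub> (a \<odot>\<^bsub>E\<^esub> x)) =
      (\<Union>u\<in>f ` X. f ` I +>\<^bsub>transport f E\<^esub> (a \<odot>\<^bsub>transport f E\<^esub> u))"
    if "X \<subseteq> carrier E" "a \<in> carrier K" for X a
    using that by (simp add: image_UN) (intro SUP_cong refl; auto simp: T coset subset_iff)
  ultimately show ?thesis
    unfolding lie_iso_def lie_quotient_def
    by (simp add: bij_betw_def car sub)
qed

lemma lie_iso_comp:
  assumes "h \<in> lie_iso K L M" "h' \<in> lie_iso K M N"
  shows "h' \<circ> h \<in> lie_iso K L N"
proof -
  have "h x \<in> carrier M" if "x \<in> carrier L" for x
    using assms(1) that by (auto simp: lie_iso_def bij_betw_apply)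
  moreover have "bij_betw (h' \<circ> h) (carrier L) (carrier N)"
    using assms by (auto simp: lie_iso_def intro: bij_betw_trans)
  ultimately show ?thesis
    using assms by (simp add: lie_iso_def)
qed

theorem capableI:
  fixes K :: "('a, 'b) ring_scheme" and E :: "('a, 'v, 'c) module_scheme"
  assumes E: "lie_algebra K E" and fd: "fin_dim K E"
    and iso: "lie_isomorphic K L (lie_quotient E (lie_center E))"
  shows "capable K L"
proof -
  interpret E: lie_algebra K E by fact
  obtain n :: nat and b where
    "\<forall>v \<in> carrier E. \<exists>c \<in> {..<n} \<rightarrow> carrier K. v = (\<Oplus>\<^bsub>E\<^esub>i\<in>{..<n}. c i \<odot>\<^bsub>E\<^esub> b i)"
    using fd unfolding fin_dim_def by blast
  then obtain f where f: "\<And>v. v \<in> carrier E \<Longrightarrow> v = (\<Oplus>\<^bsub>E\<^esub>i\<in>{..<n}. f v i \<odot>\<^bsub>E\<^esub> b i)"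
    by metis
  have inj: "inj_on f (carrier E)"
    by (rule inj_onI) (metis f)
  let ?T = "transport f E"
  obtain h where h: "h \<in> lie_iso K L (lie_quotient E (lie_center E))"
    using iso unfolding lie_isomorphic_def by blast
  have "image f \<in> lie_iso K (lie_quotient E (lie_center E)) (lie_quotient ?T (lie_center ?T))"
    unfolding transport_center[OF E inj]
    by (rule transport_quotient[OF E inj]) (auto simp: lie_center_def)
  with h have "image f \<circ> h \<in> lie_iso K L (lie_quotient ?T (lie_center ?T))"
    by (rule lie_iso_comp)
  then show ?thesis
    unfolding capable_def lie_isomorphic_def
    using transport_lie_algebra[OF E inj] transport_fin_dim[OF E inj fd] by blast
qed


section \<open>The Heisenberg Lie algebra\<close>

text \<open>Labels of the basis vectors \<open>x\<^sub>i\<close>, \<open>y\<^sub>i\<close>, \<open>z\<close>.\<close>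

datatype heis_index = HX nat | HY nat | HZ

definition heis_indices :: "nat \<Rightarrow> heis_index set" where
  "heis_indices m = HX ` {1..m} \<union> HY ` {1..m} \<union> {HZ}"

text \<open>
  Elements are the coordinate families with respect to the basis.  The bracket is the bilinear
  extension of \<open>[x\<^sub>i, y\<^sub>i] = z = - [y\<^sub>i, x\<^sub>i]\<close>; see \<open>heisenberg_brackets\<close> below.
\<close>

definition heisenberg :: "('a, 'b) ring_scheme \<Rightarrow> nat \<Rightarrow> ('a, heis_index \<Rightarrow> 'a) module" where
  "heisenberg K m =
    \<lparr>carrier = heis_indices m \<rightarrow>\<^sub>E carrier K,
     mult = (\<lambda>v w. \<lambda>k\<in>heis_indices m.
       if k = HZ
       then (\<Oplus>\<^bsub>K\<^esub>i\<in>{1..m}. v (HX i) \<otimes>\<^bsub>K\<^esub> w (HY i) \<ominus>\<^bsub>K\<^esub> v (HY i) \<otimes>\<^bsub>K\<^esub> w (HX i))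
       else \<zero>\<^bsub>K\<^esub>),
     one = undefined,
     zero = (\<lambda>k\<in>heis_indices m. \<zero>\<^bsub>K\<^esub>),
     add = (\<lambda>v w. \<lambda>k\<in>heis_indices m. v k \<oplus>\<^bsub>K\<^esub> w k),
     smult = (\<lambda>a v. \<lambda>k\<in>heis_indices m. a \<otimes>\<^bsub>K\<^esub> v k)\<rparr>"

definition heis_basis :: "('a, 'b) ring_scheme \<Rightarrow> nat \<Rightarrow> heis_index \<Rightarrow> heis_index \<Rightarrow> 'a" where
  "heis_basis K m j = (\<lambda>k\<in>heis_indices m. if k = j then \<one>\<^bsub>K\<^esub> else \<zero>\<^bsub>K\<^esub>)"

lemma card_heis_indices: "card (heis_indices m) = 2 * m + 1"
proof -
  have "card (HX ` {1..m} \<union> HY ` {1..m}) = m + m"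
    by (subst card_Un_disjoint) (auto simp: card_image inj_on_def)
  then show ?thesis
    unfolding heis_indices_def by (subst card_Un_disjoint) auto
qed

lemma heis_indices_iff [simp]:
  "HX i \<in> heis_indices m \<longleftrightarrow> i \<in> {1..m}"
  "HY i \<in> heis_indices m \<longleftrightarrow> i \<in> {1..m}"
  "HZ \<in> heis_indices m"
  by (auto simp: heis_indices_def)

lemma finite_heis_indices [simp]: "finite (heis_indices m)"
  by (simp add: heis_indices_def)

lemma heisenberg_lie_algebra:
  assumes "field K"
  shows "lie_algebra K (heisenberg K m)"
proof -
  interpret K: field K by fact
  let ?H = "heisenberg K m"
  note H = heisenberg_def
  have ext: "v = w" if "v \<in> carrier ?H" "w \<in> carrier ?H"
    "\<And>k. k \<in> heis_indices m \<Longrightarrow> v k = w k" for v w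
    using that by (auto simp: H intro: PiE_ext)
  have mem: "v k \<in> carrier K" if "v \<in> carrier ?H" "k \<in> heis_indices m" for v k
    using that by (auto simp: H)
  have mem': "v k \<in> carrier K" if "v \<in> heis_indices m \<rightarrow>\<^sub>E carrier K" "k \<in> heis_indices m" for v k
    using that by auto
  let ?b = "\<lambda>v w i. v (HX i) \<otimes>\<^bsub>K\<^esub> w (HY i) \<ominus>\<^bsub>K\<^esub> v (HY i) \<otimes>\<^bsub>K\<^esub> w (HX i)"
  have bm: "?b v w \<in> {1..m} \<rightarrow> carrier K" if "v \<in> carrier ?H" "w \<in> carrier ?H" for v w
    using mem[OF that(1)] mem[OF that(2)] by auto
  have ag: "abelian_group ?H"
  proof (rule abelian_groupI)
    fix u assume u: "u \<in> carrier ?H"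
    show "\<exists>y\<in>carrier ?H. y \<oplus>\<^bsub>?H\<^esub> u = \<zero>\<^bsub>?H\<^esub>"
      by (rule bexI[of _ "\<lambda>k\<in>heis_indices m. \<ominus>\<^bsub>K\<^esub> u k"])
        (use u mem[OF u] in \<open>auto simp: H K.l_neg intro!: restrict_ext\<close>)
  next
    fix x assume "x \<in> carrier ?H"
    then show "\<zero>\<^bsub>?H\<^esub> \<oplus>\<^bsub>?H\<^esub> x = x"
      by (intro ext) (auto simp: H mem')
  qed (auto simp: H mem' K.a_ac intro!: restrict_ext)
  have md: "module K ?H"
  proof (rule moduleI[OF K.is_cring ag])
    fix x assume "x \<in> carrier ?H"
    then show "\<one>\<^bsub>K\<^esub> \<odot>\<^bsub>?H\<^esub> x = x"
      by (intro ext) (auto simp: H mem')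
  qed (auto simp: H mem' K.m_assoc K.l_distr K.r_distr intro!: restrict_ext)
  have mult: "v \<otimes>\<^bsub>?H\<^esub> w = (\<lambda>k\<in>heis_indices m. if k = HZ then finsum K (?b v w) {1..m} else \<zero>\<^bsub>K\<^esub>)"
    for v w by (simp add: H)
  have closed: "v \<otimes>\<^bsub>?H\<^esub> w \<in> carrier ?H" if "v \<in> carrier ?H" "w \<in> carrier ?H" for v w
    unfolding mult using K.finsum_closed[OF bm[OF that]] by (auto simp: H)
  have central: "u \<otimes>\<^bsub>?H\<^esub> (v \<otimes>\<^bsub>?H\<^esub> w) = \<zero>\<^bsub>?H\<^esub>" if "u \<in> carrier ?H" for u v w
  proof -
    have "finsum K (?b u (v \<otimes>\<^bsub>?H\<^esub> w)) {1..m} = finsum K (\<lambda>_. \<zero>\<^bsub>K\<^esub>) {1..m}"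
      using mem[OF that] by (intro K.finsum_cong') (auto simp: mult K.minus_eq)
    then have "finsum K (?b u (v \<otimes>\<^bsub>?H\<^esub> w)) {1..m} = \<zero>\<^bsub>K\<^esub>"
      by (simp add: K.finsum_zero)
    then show ?thesis
      unfolding mult[of u] by (auto simp: H intro!: restrict_ext)
  qed
  show ?thesis
  proof (intro lie_algebra.intro md K.field_axioms lie_algebra_axioms.intro closed)
    fix x y z assume c: "x \<in> carrier ?H" "y \<in> carrier ?H" "z \<in> carrier ?H"
    have "finsum K (?b (x \<oplus>\<^bsub>?H\<^esub> y) z) {1..m} =
        finsum K (\<lambda>i. ?b x z i \<oplus>\<^bsub>K\<^esub> ?b y z i) {1..m}"
    proof (rule K.finsum_cong')
      fix i assume i: "i \<in> {1..m}"
      show "?b (x \<oplus>\<^bsub>?H\<^esub> y) z i = ?b x z i \<oplus>\<^bsub>K\<^esub> ?b y z i"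
        using i mem[OF c(1), of "HX i"] mem[OF c(1), of "HY i"] mem[OF c(2), of "HX i"]
          mem[OF c(2), of "HY i"] mem[OF c(3), of "HX i"] mem[OF c(3), of "HY i"]
        by (simp add: H) algebra
    qed (use bm[OF c(1,3)] bm[OF c(2,3)] in auto)
    also have "\<dots> = finsum K (?b x z) {1..m} \<oplus>\<^bsub>K\<^esub> finsum K (?b y z) {1..m}"
      by (rule K.finsum_addf[OF bm[OF c(1,3)] bm[OF c(2,3)]])
    finally show "(x \<oplus>\<^bsub>?H\<^esub> y) \<otimes>\<^bsub>?H\<^esub> z = x \<otimes>\<^bsub>?H\<^esub> z \<oplus>\<^bsub>?H\<^esub> y \<otimes>\<^bsub>?H\<^esub> z"
      unfolding mult by (auto simp: H intro!: restrict_ext)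
    have "finsum K (?b x (y \<oplus>\<^bsub>?H\<^esub> z)) {1..m} =
        finsum K (\<lambda>i. ?b x y i \<oplus>\<^bsub>K\<^esub> ?b x z i) {1..m}"
    proof (rule K.finsum_cong')
      fix i assume i: "i \<in> {1..m}"
      show "?b x (y \<oplus>\<^bsub>?H\<^esub> z) i = ?b x y i \<oplus>\<^bsub>K\<^esub> ?b x z i"
        using i mem[OF c(1), of "HX i"] mem[OF c(1), of "HY i"] mem[OF c(2), of "HX i"]
          mem[OF c(2), of "HY i"] mem[OF c(3), of "HX i"] mem[OF c(3), of "HY i"]
        by (simp add: H) algebra
    qed (use bm[OF c(1,3)] bm[OF c(1,2)] in auto)
    also have "\<dots> = finsum K (?b x y) {1..m} \<oplus>\<^bsub>K\<^esub> finsum K (?b x z) {1..m}"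
      by (rule K.finsum_addf[OF bm[OF c(1,2)] bm[OF c(1,3)]])
    finally show "x \<otimes>\<^bsub>?H\<^esub> (y \<oplus>\<^bsub>?H\<^esub> z) = x \<otimes>\<^bsub>?H\<^esub> y \<oplus>\<^bsub>?H\<^esub> x \<otimes>\<^bsub>?H\<^esub> z"
      unfolding mult by (auto simp: H intro!: restrict_ext)
    interpret md: module K ?H by (rule md)
    show "x \<otimes>\<^bsub>?H\<^esub> (y \<otimes>\<^bsub>?H\<^esub> z) \<oplus>\<^bsub>?H\<^esub> y \<otimes>\<^bsub>?H\<^esub> (z \<otimes>\<^bsub>?H\<^esub> x) \<oplus>\<^bsub>?H\<^esub> z \<otimes>\<^bsub>?H\<^esub> (x \<otimes>\<^bsub>?H\<^esub> y) = \<zero>\<^bsub>?H\<^esub>"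
      by (simp add: central c)
  next
    fix a x y assume a: "a \<in> carrier K" and c: "x \<in> carrier ?H" "y \<in> carrier ?H"
    have "finsum K (?b (a \<odot>\<^bsub>?H\<^esub> x) y) {1..m} = finsum K (\<lambda>i. a \<otimes>\<^bsub>K\<^esub> ?b x y i) {1..m}"
    proof (rule K.finsum_cong')
      fix i assume i: "i \<in> {1..m}"
      show "?b (a \<odot>\<^bsub>?H\<^esub> x) y i = a \<otimes>\<^bsub>K\<^esub> ?b x y i"
        using i a mem[OF c(1), of "HX i"] mem[OF c(1), of "HY i"] mem[OF c(2), of "HX i"]
          mem[OF c(2), of "HY i"]
        by (simp add: H) algebra
    qed (use bm[OF c] a in auto)
    also have "\<dots> = a \<otimes>\<^bsub>K\<^esub> finsum K (?b x y) {1..m}"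
      by (rule K.finsum_rdistr[OF _ a bm[OF c], symmetric]) simp
    finally show "(a \<odot>\<^bsub>?H\<^esub> x) \<otimes>\<^bsub>?H\<^esub> y = a \<odot>\<^bsub>?H\<^esub> (x \<otimes>\<^bsub>?H\<^esub> y)"
      unfolding mult using a by (auto simp: H intro!: restrict_ext)
    have "finsum K (?b x (a \<odot>\<^bsub>?H\<^esub> y)) {1..m} = finsum K (\<lambda>i. a \<otimes>\<^bsub>K\<^esub> ?b x y i) {1..m}"
    proof (rule K.finsum_cong')
      fix i assume i: "i \<in> {1..m}"
      show "?b x (a \<odot>\<^bsub>?H\<^esub> y) i = a \<otimes>\<^bsub>K\<^esub> ?b x y i"
        using i a mem[OF c(1), of "HX i"] mem[OF c(1), of "HY i"] mem[OF c(2), of "HX i"]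
          mem[OF c(2), of "HY i"]
        by (simp add: H) algebra
    qed (use bm[OF c] a in auto)
    also have "\<dots> = a \<otimes>\<^bsub>K\<^esub> finsum K (?b x y) {1..m}"
      by (rule K.finsum_rdistr[OF _ a bm[OF c], symmetric]) simp
    finally show "x \<otimes>\<^bsub>?H\<^esub> (a \<odot>\<^bsub>?H\<^esub> y) = a \<odot>\<^bsub>?H\<^esub> (x \<otimes>\<^bsub>?H\<^esub> y)"
      unfolding mult using a by (auto simp: H intro!: restrict_ext)
  next
    fix x assume c: "x \<in> carrier ?H"
    have "finsum K (?b x x) {1..m} = finsum K (\<lambda>_. \<zero>\<^bsub>K\<^esub>) {1..m}"
      using mem[OF c] by (intro K.finsum_cong') (auto simp: K.m_comm K.minus_eq K.r_neg)
    then show "x \<otimes>\<^bsub>?H\<^esub> x = \<zero>\<^bsub>?H\<^esub>"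
      unfolding mult by (auto simp: H K.finsum_zero intro!: restrict_ext)
  qed
qed

lemma heisenberg_brackets:
  assumes "field K" "i \<in> {1..m}" "j \<in> {1..m}" "k \<in> heis_indices m"
  defines "H \<equiv> heisenberg K m" and "e \<equiv> heis_basis K m"
  shows "e (HX i) \<otimes>\<^bsub>H\<^esub> e (HY j) = (if i = j then e HZ else \<zero>\<^bsub>H\<^esub>)"
    and "e (HX i) \<otimes>\<^bsub>H\<^esub> e (HX j) = \<zero>\<^bsub>H\<^esub>"
    and "e (HY i) \<otimes>\<^bsub>H\<^esub> e (HY j) = \<zero>\<^bsub>H\<^esub>"
    and "e HZ \<otimes>\<^bsub>H\<^esub> e k = \<zero>\<^bsub>H\<^esub>"
proof -
  interpret K: field K by fact
  have fs: "finsum K (\<lambda>l. (if l = i then \<one>\<^bsub>K\<^esub> else \<zero>\<^bsub>K\<^esub>) \<otimes>\<^bsub>K\<^esub> (if l = j then \<one>\<^bsub>K\<^esub> else \<zero>\<^bsub>K\<^esub>) \<ominus>\<^bsub>K\<^esub> \<zero>\<^bsub>K\<^esub>)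
      {1..m} = (if i = j then \<one>\<^bsub>K\<^esub> else \<zero>\<^bsub>K\<^esub>)" (is "finsum K ?f _ = _")
  proof -
    have "finsum K ?f {1..m} = finsum K (\<lambda>l. if i = l then (if i = j then \<one>\<^bsub>K\<^esub> else \<zero>\<^bsub>K\<^esub>) else \<zero>\<^bsub>K\<^esub>) {1..m}"
      by (intro K.finsum_cong') (auto simp: K.minus_eq)
    also have "\<dots> = (if i = j then \<one>\<^bsub>K\<^esub> else \<zero>\<^bsub>K\<^esub>)"
      using K.finsum_singleton[OF assms(2), of "\<lambda>_. if i = j then \<one>\<^bsub>K\<^esub> else \<zero>\<^bsub>K\<^esub>"] by simp
    finally show ?thesis .
  qed
  have eX: "e l (HX n) = (if HX n = l then \<one>\<^bsub>K\<^esub> else \<zero>\<^bsub>K\<^esub>)"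
    and eY: "e l (HY n) = (if HY n = l then \<one>\<^bsub>K\<^esub> else \<zero>\<^bsub>K\<^esub>)" if "n \<in> {1..m}" for l n
    using that by (auto simp: e_def heis_basis_def)
  have mult: "u \<otimes>\<^bsub>H\<^esub> v = (\<lambda>k\<in>heis_indices m. if k = HZ then s else \<zero>\<^bsub>K\<^esub>)"
    if "(\<Oplus>\<^bsub>K\<^esub>i\<in>{1..m}. u (HX i) \<otimes>\<^bsub>K\<^esub> v (HY i) \<ominus>\<^bsub>K\<^esub> u (HY i) \<otimes>\<^bsub>K\<^esub> v (HX i)) = s" for u v s
    unfolding that[symmetric] by (simp add: H_def heisenberg_def)
  have zero: "\<zero>\<^bsub>H\<^esub> = (\<lambda>k\<in>heis_indices m. if k = HZ then \<zero>\<^bsub>K\<^esub> else \<zero>\<^bsub>K\<^esub>)"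
    by (simp add: H_def heisenberg_def)
  have zs: "(\<Oplus>\<^bsub>K\<^esub>i\<in>{1..m}. f i) = \<zero>\<^bsub>K\<^esub>" if "\<And>i. i \<in> {1..m} \<Longrightarrow> f i = \<zero>\<^bsub>K\<^esub>" for f
  proof -
    have "(\<Oplus>\<^bsub>K\<^esub>i\<in>{1..m}. f i) = (\<Oplus>\<^bsub>K\<^esub>i\<in>{1..m}. \<zero>\<^bsub>K\<^esub>)"
      using that by (intro K.finsum_cong') auto
    then show ?thesis by (simp add: K.finsum_zero)
  qed
  show "e (HX i) \<otimes>\<^bsub>H\<^esub> e (HY j) = (if i = j then e HZ else \<zero>\<^bsub>H\<^esub>)"
  proof -
    have "(\<Oplus>\<^bsub>K\<^esub>l\<in>{1..m}. e (HX i) (HX l) \<otimes>\<^bsub>K\<^esub> e (HY j) (HY l) \<ominus>\<^bsub>K\<^esub> e (HX i) (HY l) \<otimes>\<^bsub>K\<^esub> e (HY j) (HX l))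
      = finsum K ?f {1..m}"
      by (intro K.finsum_cong') (auto simp: eX eY)
    then have "e (HX i) \<otimes>\<^bsub>H\<^esub> e (HY j) =
        (\<lambda>k\<in>heis_indices m. if k = HZ then (if i = j then \<one>\<^bsub>K\<^esub> else \<zero>\<^bsub>K\<^esub>) else \<zero>\<^bsub>K\<^esub>)"
      by (intro mult) (simp only: fs)
    also have "\<dots> = (if i = j then e HZ else \<zero>\<^bsub>H\<^esub>)"
      by (auto simp: zero e_def heis_basis_def)
    finally show ?thesis .
  qed
  show "e (HX i) \<otimes>\<^bsub>H\<^esub> e (HX j) = \<zero>\<^bsub>H\<^esub>"
    unfolding zero by (intro mult zs) (auto simp: eX eY K.minus_eq)
  show "e (HY i) \<otimes>\<^bsub>H\<^esub> e (HY j) = \<zero>\<^bsub>H\<^esub>"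
    unfolding zero by (intro mult zs) (auto simp: eX eY K.minus_eq)
  show "e HZ \<otimes>\<^bsub>H\<^esub> e k = \<zero>\<^bsub>H\<^esub>"
    unfolding zero by (intro mult zs) (auto simp: eX eY K.minus_eq)
qed

end

theory Submission
  imports Defs
begin

text \<open>
  By the homomorphism theorem, \<open>L \<cong> E / Z(E)\<close> means that there is a surjective homomorphism
  \<open>\<phi> : E \<rightarrow> L\<close> with kernel \<open>Z(E)\<close> (\<open>lie_isomorphic_quotient_iff\<close>).  Both directions work with
  such a \<open>\<phi>\<close> rather than with cosets.

  For \<open>m = 1\<close> take the four-dimensional filiform algebra with basis \<open>x, y, z, w\<close> and brackets
  \<open>[x, y] = z\<close>, \<open>[x, z] = w\<close>.  Its center is spanned by \<open>w\<close>, and forgetting the coordinate of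
  \<open>w\<close> maps it onto \<open>H(1)\<close> (\<open>heisenberg_1_capable\<close>).

  For \<open>m \<ge> 2\<close> suppose that \<open>\<phi> : E \<rightarrow> H(m)\<close> is surjective with kernel \<open>Z(E)\<close>, and let \<open>X\<^sub>i, Y\<^sub>i, W\<close>
  be lifts of \<open>x\<^sub>i, y\<^sub>i, z\<close>.  Brackets in \<open>E\<close> depend only on the images under \<open>\<phi>\<close>.  Hence, for
  every \<open>u \<in> E\<close> and every \<open>i\<close>, the Jacobi identity for \<open>X\<^sub>i, Y\<^sub>i, u\<close> reads
  \<open>[u, W] = a [X\<^sub>i, W] + b [Y\<^sub>i, W]\<close>, where \<open>a\<close> and \<open>b\<close> are the coordinates of \<open>\<phi> u\<close> at \<open>x\<^sub>i\<close> and
  \<open>y\<^sub>i\<close>.  With \<open>i = 2\<close> this gives \<open>[X\<^sub>1, W] = [Y\<^sub>1, W] = 0\<close>; then \<open>i = 1\<close> gives \<open>[u, W] = 0\<close> for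
  all \<open>u\<close>.  So \<open>W\<close> is central and \<open>z = \<phi> W = 0\<close>, a contradiction (\<open>heisenberg_not_capable\<close>).
\<close>

section \<open>Ideals and quotients of Lie algebras\<close>

text \<open>Homomorphisms of Lie algebras over \<open>K\<close>; their values outside the carrier are arbitrary.\<close>

definition lie_hom ::
  "('a, 'b) ring_scheme \<Rightarrow> ('a, 'v, 'c) module_scheme \<Rightarrow> ('a, 'w, 'd) module_scheme \<Rightarrow> ('v \<Rightarrow> 'w) set"
  where
  "lie_hom K L M = {h \<in> carrier L \<rightarrow> carrier M.
    (\<forall>x \<in> carrier L. \<forall>y \<in> carrier L. h (x \<oplus>\<^bsub>L\<^esub> y) = h x \<oplus>\<^bsub>M\<^esub> h y) \<and>
    (\<forall>a \<in> carrier K. \<forall>x \<in> carrier L. h (a \<odot>\<^bsub>L\<^esub> x) = a \<odot>\<^bsub>M\<^esub> h x) \<and>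
    (\<forall>x \<in> carrier L. \<forall>y \<in> carrier L. h (x \<otimes>\<^bsub>L\<^esub> y) = h x \<otimes>\<^bsub>M\<^esub> h y)}"

lemma lie_homD:
  assumes "h \<in> lie_hom K L M"
  shows "x \<in> carrier L \<Longrightarrow> h x \<in> carrier M"
    and "\<lbrakk>x \<in> carrier L; y \<in> carrier L\<rbrakk> \<Longrightarrow> h (x \<oplus>\<^bsub>L\<^esub> y) = h x \<oplus>\<^bsub>M\<^esub> h y"
    and "\<lbrakk>a \<in> carrier K; x \<in> carrier L\<rbrakk> \<Longrightarrow> h (a \<odot>\<^bsub>L\<^esub> x) = a \<odot>\<^bsub>M\<^esub> h x"
    and "\<lbrakk>x \<in> carrier L; y \<in> carrier L\<rbrakk> \<Longrightarrow> h (x \<otimes>\<^bsub>L\<^esub> y) = h x \<otimes>\<^bsub>M\<^esub> h y"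
  using assms by (auto simp: lie_hom_def)

text \<open>
  Ideals of a Lie algebra.  Absorption is required on one side only; the other side and closure under
  negation follow (\<open>lie_idealD\<close>).
\<close>

definition lie_ideal ::
  "('a, 'b) ring_scheme \<Rightarrow> ('a, 'v, 'c) module_scheme \<Rightarrow> 'v set \<Rightarrow> bool" where
  "lie_ideal K L I \<longleftrightarrow> I \<subseteq> carrier L \<and> \<zero>\<^bsub>L\<^esub> \<in> I \<and>
    (\<forall>x \<in> I. \<forall>y \<in> I. x \<oplus>\<^bsub>L\<^esub> y \<in> I) \<and> (\<forall>a \<in> carrier K. \<forall>x \<in> I. a \<odot>\<^bsub>L\<^esub> x \<in> I) \<and>
    (\<forall>x \<in> carrier L. \<forall>y \<in> I. x \<otimes>\<^bsub>L\<^esub> y \<in> I)"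

lemma (in lie_algebra) bracket_skew:
  assumes "x \<in> carrier L" "y \<in> carrier L"
  shows "x \<otimes>\<^bsub>L\<^esub> y = \<ominus>\<^bsub>L\<^esub> (y \<otimes>\<^bsub>L\<^esub> x)"
proof -
  have "\<zero>\<^bsub>L\<^esub> = (x \<oplus>\<^bsub>L\<^esub> y) \<otimes>\<^bsub>L\<^esub> (x \<oplus>\<^bsub>L\<^esub> y)"
    using assms by (simp add: bracket_self)
  also have "\<dots> = x \<otimes>\<^bsub>L\<^esub> y \<oplus>\<^bsub>L\<^esub> y \<otimes>\<^bsub>L\<^esub> x"
    using assms by (simp add: bracket_add_left bracket_add_right bracket_closed L.M.a_comm
        bracket_self[OF assms(1)] bracket_self[OF assms(2)])
  finally show ?thesis
    using assms by (metis L.M.minus_equality bracket_closed)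
qed

lemma (in lie_algebra) lie_idealD:
  assumes "lie_ideal K L I"
  shows "x \<in> I \<Longrightarrow> x \<in> carrier L" and "\<zero>\<^bsub>L\<^esub> \<in> I"
    and "\<lbrakk>x \<in> I; y \<in> I\<rbrakk> \<Longrightarrow> x \<oplus>\<^bsub>L\<^esub> y \<in> I" and "x \<in> I \<Longrightarrow> \<ominus>\<^bsub>L\<^esub> x \<in> I"
    and "\<lbrakk>a \<in> carrier K; x \<in> I\<rbrakk> \<Longrightarrow> a \<odot>\<^bsub>L\<^esub> x \<in> I"
    and "\<lbrakk>x \<in> carrier L; y \<in> I\<rbrakk> \<Longrightarrow> x \<otimes>\<^bsub>L\<^esub> y \<in> I"
    and "\<lbrakk>x \<in> I; y \<in> carrier L\<rbrakk> \<Longrightarrow> x \<otimes>\<^bsub>L\<^esub> y \<in> I"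
proof -
  have neg: "\<ominus>\<^bsub>L\<^esub> x \<in> I" if "x \<in> I" for x
  proof -
    have "\<ominus>\<^bsub>L\<^esub> x = (\<ominus>\<^bsub>K\<^esub> \<one>\<^bsub>K\<^esub>) \<odot>\<^bsub>L\<^esub> x"
      using that assms L.smult_l_minus[of "\<one>\<^bsub>K\<^esub>" x] by (auto simp: lie_ideal_def)
    then show ?thesis using that assms by (auto simp: lie_ideal_def)
  qed
  show "x \<in> I \<Longrightarrow> \<ominus>\<^bsub>L\<^esub> x \<in> I" by (rule neg)
  show "\<lbrakk>x \<in> I; y \<in> carrier L\<rbrakk> \<Longrightarrow> x \<otimes>\<^bsub>L\<^esub> y \<in> I"
    using assms neg[of "y \<otimes>\<^bsub>L\<^esub> x"] bracket_skew[of x y] by (auto simp: lie_ideal_def subset_iff)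
qed (use assms in \<open>auto simp: lie_ideal_def\<close>)

lemma (in lie_algebra) center_lie_ideal: "lie_ideal K L (lie_center L)"
proof -
  have "x \<otimes>\<^bsub>L\<^esub> y = \<zero>\<^bsub>L\<^esub>" if "x \<in> carrier L" "y \<in> lie_center L" for x y
    using that bracket_skew[of x y] by (simp add: lie_center_def)
  moreover have "\<zero>\<^bsub>L\<^esub> \<otimes>\<^bsub>L\<^esub> y = \<zero>\<^bsub>L\<^esub>" if "y \<in> carrier L" for y
    using that bracket_smult_left[of "\<zero>\<^bsub>K\<^esub>" y y] bracket_closed by simp
  ultimately show ?thesis
    by (auto simp: lie_ideal_def lie_center_def bracket_closed bracket_add_left bracket_smult_left)
qed

lemma (in lie_algebra) coset_eq_iff:
  assumes I: "lie_ideal K L I" and x: "x \<in> carrier L" and y: "y \<in> carrier L"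
  shows "I +>\<^bsub>L\<^esub> x = I +>\<^bsub>L\<^esub> y \<longleftrightarrow> x \<ominus>\<^bsub>L\<^esub> y \<in> I"
proof
  note D = lie_idealD[OF I]
  assume "I +>\<^bsub>L\<^esub> x = I +>\<^bsub>L\<^esub> y"
  moreover have "\<zero>\<^bsub>L\<^esub> \<oplus>\<^bsub>L\<^esub> x \<in> I +>\<^bsub>L\<^esub> x"
    using D(2) by (auto simp: a_r_coset_def')
  ultimately obtain i where "i \<in> I" "x = i \<oplus>\<^bsub>L\<^esub> y"
    using x by (auto simp: a_r_coset_def')
  then show "x \<ominus>\<^bsub>L\<^esub> y \<in> I"
    using y D(1) by (simp add: L.M.minus_eq L.M.a_assoc L.M.r_neg)
next
  note D = lie_idealD[OF I]
  have incl: "I +>\<^bsub>L\<^esub> u \<subseteq> I +>\<^bsub>L\<^esub> v" if uv: "u \<ominus>\<^bsub>L\<^esub> v \<in> I" "u \<in> carrier L" "v \<in> carrier L" for u v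
  proof
    fix t assume "t \<in> I +>\<^bsub>L\<^esub> u"
    then obtain i where i: "i \<in> I" "t = i \<oplus>\<^bsub>L\<^esub> u" by (auto simp: a_r_coset_def')
    then have "t = (i \<oplus>\<^bsub>L\<^esub> (u \<ominus>\<^bsub>L\<^esub> v)) \<oplus>\<^bsub>L\<^esub> v"
      using uv D(1) by (simp add: L.M.minus_eq L.M.a_assoc L.M.l_neg)
    then show "t \<in> I +>\<^bsub>L\<^esub> v"
      using i uv D(3) by (auto simp: a_r_coset_def')
  qed
  assume xy: "x \<ominus>\<^bsub>L\<^esub> y \<in> I"
  have "y \<ominus>\<^bsub>L\<^esub> x = \<ominus>\<^bsub>L\<^esub> (x \<ominus>\<^bsub>L\<^esub> y)"
    using x y by (simp add: L.M.minus_eq L.M.minus_add L.M.a_comm)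
  then have "y \<ominus>\<^bsub>L\<^esub> x \<in> I" using D(4)[OF xy] by simp
  with xy x y show "I +>\<^bsub>L\<^esub> x = I +>\<^bsub>L\<^esub> y"
    by (intro subset_antisym incl)
qed

lemma (in lie_algebra) lie_quotient_hom:
  assumes I: "lie_ideal K L I"
  shows "(\<lambda>x. I +>\<^bsub>L\<^esub> x) \<in> lie_hom K L (lie_quotient L I)"
proof -
  note D = lie_idealD[OF I]
  have self: "x \<in> I +>\<^bsub>L\<^esub> x" if "x \<in> carrier L" for x
    using D(2) that by (force simp: a_r_coset_def')
  have absorb: "I +>\<^bsub>L\<^esub> (i \<oplus>\<^bsub>L\<^esub> x) = I +>\<^bsub>L\<^esub> x" if "i \<in> I" "x \<in> carrier L" for i x
    using that D(1) coset_eq_iff[OF I, of "i \<oplus>\<^bsub>L\<^esub> x" x]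
    by (simp add: L.M.minus_eq L.M.a_assoc L.M.r_neg)
  have add: "I +>\<^bsub>L\<^esub> (x \<oplus>\<^bsub>L\<^esub> y) = (I +>\<^bsub>L\<^esub> x) <+>\<^bsub>L\<^esub> (I +>\<^bsub>L\<^esub> y)"
    if xy: "x \<in> carrier L" "y \<in> carrier L" for x y
  proof -
    have "abelian_subgroup I L"
      using D(2) L.M.abelian_group_axioms
      by (intro abelian_subgroupI3 additive_subgroup.intro L.M.add.subgroupI)
        (auto simp: D(1,3,4) a_inv_def[symmetric])
    then show ?thesis using xy by (simp add: abelian_subgroup.a_rcos_sum)
  qed
  have smult: "I +>\<^bsub>L\<^esub> (a \<odot>\<^bsub>L\<^esub> x) = (\<Union>u\<in>I +>\<^bsub>L\<^esub> x. I +>\<^bsub>L\<^esub> (a \<odot>\<^bsub>L\<^esub> u))"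
    if a: "a \<in> carrier K" and x: "x \<in> carrier L" for a x
  proof -
    have "I +>\<^bsub>L\<^esub> (a \<odot>\<^bsub>L\<^esub> u) = I +>\<^bsub>L\<^esub> (a \<odot>\<^bsub>L\<^esub> x)" if "u \<in> I +>\<^bsub>L\<^esub> x" for u
    proof -
      obtain i where "i \<in> I" "u = i \<oplus>\<^bsub>L\<^esub> x" using \<open>u \<in> _\<close> by (auto simp: a_r_coset_def')
      then show ?thesis using a x D(1,5) by (simp add: L.smult_r_distr absorb)
    qed
    then show ?thesis using self[OF x] by blast
  qed
  have mult: "I +>\<^bsub>L\<^esub> (x \<otimes>\<^bsub>L\<^esub> y) = rcoset_mult L I (I +>\<^bsub>L\<^esub> x) (I +>\<^bsub>L\<^esub> y)"
    if x: "x \<in> carrier L" and y: "y \<in> carrier L" for x y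
  proof -
    have "I +>\<^bsub>L\<^esub> (u \<otimes>\<^bsub>L\<^esub> v) = I +>\<^bsub>L\<^esub> (x \<otimes>\<^bsub>L\<^esub> y)"
      if uv: "u \<in> I +>\<^bsub>L\<^esub> x" "v \<in> I +>\<^bsub>L\<^esub> y" for u v
    proof -
      obtain i j where ij: "i \<in> I" "u = i \<oplus>\<^bsub>L\<^esub> x" "j \<in> I" "v = j \<oplus>\<^bsub>L\<^esub> y"
        using uv by (auto simp: a_r_coset_def')
      have "u \<otimes>\<^bsub>L\<^esub> v = i \<otimes>\<^bsub>L\<^esub> v \<oplus>\<^bsub>L\<^esub> (x \<otimes>\<^bsub>L\<^esub> j \<oplus>\<^bsub>L\<^esub> x \<otimes>\<^bsub>L\<^esub> y)"
        using ij x y D(1) by (simp add: bracket_add_left bracket_add_right[of x j y] bracket_closed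
            L.M.a_assoc)
      then show ?thesis
        using ij x y D(1,6,7) bracket_closed by (simp add: absorb)
    qed
    then show ?thesis using self[OF x] self[OF y] unfolding rcoset_mult_def by blast
  qed
  show ?thesis
    by (auto simp: lie_hom_def lie_quotient_def A_RCOSETS_def' add smult mult)
qed

text \<open>
  The homomorphism theorem together with its converse: for an ideal \<open>I\<close>, the quotient \<open>E / I\<close> is a
  copy of \<open>L\<close> exactly when \<open>I\<close> is the kernel of a homomorphism from \<open>E\<close> onto \<open>L\<close>.
\<close>

lemma lie_isomorphic_quotient_iff:
  assumes E: "lie_algebra K E" and L: "lie_algebra K L" and I: "lie_ideal K E I"
  shows "lie_isomorphic K L (lie_quotient E I) \<longleftrightarrow>
    (\<exists>\<phi> \<in> lie_hom K E L. \<phi> ` carrier E = carrier L \<and> I = {x \<in> carrier E. \<phi> x = \<zero>\<^bsub>L\<^esub>})"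
    (is "_ \<longleftrightarrow> ?R")
proof -
  interpret E: lie_algebra K E by fact
  interpret L: lie_algebra K L by fact
  let ?Q = "lie_quotient E I" and ?\<pi> = "\<lambda>x. I +>\<^bsub>E\<^esub> x"
  have \<pi>: "?\<pi> \<in> lie_hom K E ?Q" by (rule E.lie_quotient_hom[OF I])
  have car: "carrier ?Q = ?\<pi> ` carrier E" by (auto simp: lie_quotient_def A_RCOSETS_def')
  have sub: "I \<subseteq> carrier E" using I by (simp add: lie_ideal_def)
  show ?thesis
  proof
    assume "lie_isomorphic K L ?Q"
    then obtain h where h: "h \<in> lie_iso K L ?Q" by (auto simp: lie_isomorphic_def)
    then have bij: "bij_betw h (carrier L) (carrier ?Q)" by (simp add: lie_iso_def)
    have "\<exists>v \<in> carrier L. h v = ?\<pi> x" if "x \<in> carrier E" for x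
      using that bij unfolding bij_betw_def car by (metis image_iff)
    \<comment> \<open>\<open>\<phi>\<close> is the projection \<open>E \<rightarrow> E / I\<close> followed by the inverse of \<open>h\<close>.\<close>
    then obtain \<phi> where \<phi>: "\<And>x. x \<in> carrier E \<Longrightarrow> \<phi> x \<in> carrier L" "\<And>x. x \<in> carrier E \<Longrightarrow> h (\<phi> x) = ?\<pi> x"
      by metis
    have eqI: "\<phi> x = v" if "x \<in> carrier E" "v \<in> carrier L" "h v = ?\<pi> x" for x v
      using that \<phi> bij by (metis bij_betw_def inj_onD)
    have hom: "\<phi> \<in> lie_hom K E L"
      unfolding lie_hom_def using h \<phi> lie_homD(2-4)[OF \<pi>]
      by (auto simp: lie_iso_def E.bracket_closed L.bracket_closed intro!: eqI)
    have surj: "\<phi> ` carrier E = carrier L"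
    proof (intro equalityI subsetI)
      fix v assume v: "v \<in> carrier L"
      then have "h v \<in> ?\<pi> ` carrier E" using bij car by (metis bij_betw_apply)
      then show "v \<in> \<phi> ` carrier E" using eqI v by (metis (no_types, lifting) imageE rev_image_eqI)
    qed (use \<phi> in auto)
    have zero: "\<phi> \<zero>\<^bsub>E\<^esub> = \<zero>\<^bsub>L\<^esub>"
      using lie_homD(3)[OF hom, of "\<zero>\<^bsub>K\<^esub>" "\<zero>\<^bsub>E\<^esub>"] \<phi>(1)[of "\<zero>\<^bsub>E\<^esub>"] by simp
    have "x \<in> I \<longleftrightarrow> \<phi> x = \<zero>\<^bsub>L\<^esub>" if x: "x \<in> carrier E" for x
    proof -
      have "x \<in> I \<longleftrightarrow> ?\<pi> x = ?\<pi> \<zero>\<^bsub>E\<^esub>"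
        using E.coset_eq_iff[OF I x, of "\<zero>\<^bsub>E\<^esub>"] x E.L.M.add.inv_one
        by (simp add: E.L.M.minus_eq a_inv_def)
      also have "\<dots> \<longleftrightarrow> \<phi> x = \<phi> \<zero>\<^bsub>E\<^esub>"
        using \<phi>(2)[OF x] \<phi>(2)[OF E.L.M.zero_closed] eqI[OF x \<phi>(1)[OF E.L.M.zero_closed]] by auto
      finally show ?thesis by (simp add: zero)
    qed
    with hom surj sub show ?R by blast
  next
    assume ?R
    then obtain \<phi> where hom: "\<phi> \<in> lie_hom K E L" and surj: "\<phi> ` carrier E = carrier L"
      and ker: "I = {x \<in> carrier E. \<phi> x = \<zero>\<^bsub>L\<^esub>}" by blast
    note \<phi> = lie_homD[OF hom]
    have minus: "\<phi> (x \<ominus>\<^bsub>E\<^esub> y) = \<phi> x \<ominus>\<^bsub>L\<^esub> \<phi> y" if "x \<in> carrier E" "y \<in> carrier E" for x y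
    proof -
      have "\<phi> (x \<ominus>\<^bsub>E\<^esub> y) \<oplus>\<^bsub>L\<^esub> \<phi> y = \<phi> x"
        using that by (simp add: \<phi>(2)[symmetric] E.L.M.minus_eq E.L.M.a_assoc E.L.M.l_neg)
      then show ?thesis
        using that \<phi>(1) by (metis E.L.M.minus_closed L.L.M.add.inv_solve_right' L.L.M.minus_eq a_inv_def)
    qed
    have coset: "?\<pi> x = ?\<pi> y \<longleftrightarrow> \<phi> x = \<phi> y" if "x \<in> carrier E" "y \<in> carrier E" for x y
    proof -
      have "?\<pi> x = ?\<pi> y \<longleftrightarrow> x \<ominus>\<^bsub>E\<^esub> y \<in> I" by (rule E.coset_eq_iff[OF I that])
      also have "\<dots> \<longleftrightarrow> \<phi> x = \<phi> y" using that \<phi>(1) by (simp add: ker minus L.L.M.minus_eq L.L.M.add.inv_solve_right')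
      finally show ?thesis .
    qed
    \<comment> \<open>A set-theoretic section of \<open>\<phi>\<close>; the isomorphism maps \<open>v\<close> to the coset of \<open>s v\<close>.\<close>
    obtain s where s: "\<And>v. v \<in> carrier L \<Longrightarrow> s v \<in> carrier E" "\<And>v. v \<in> carrier L \<Longrightarrow> \<phi> (s v) = v"
    proof -
      have "\<exists>x. x \<in> carrier E \<and> \<phi> x = v" if "v \<in> carrier L" for v
        using that unfolding surj[symmetric] by blast
      then show thesis using that by metis
    qed
    let ?h = "\<lambda>v. ?\<pi> (s v)"
    have h\<phi>: "?h (\<phi> x) = ?\<pi> x" if "x \<in> carrier E" for x
      using that s \<phi>(1) coset by simp
    have "bij_betw ?h (carrier L) (carrier ?Q)"
      unfolding bij_betw_def
    proof
      show "inj_on ?h (carrier L)"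
        by (rule inj_onI) (use s coset in metis)
      show "?h ` carrier L = carrier ?Q"
        unfolding car surj[symmetric] image_image using h\<phi> by (intro image_cong) auto
    qed
    moreover have "?h (v \<oplus>\<^bsub>L\<^esub> w) = ?h v \<oplus>\<^bsub>?Q\<^esub> ?h w" if "v \<in> carrier L" "w \<in> carrier L" for v w
      using that s h\<phi>[of "s v \<oplus>\<^bsub>E\<^esub> s w"] by (simp add: \<phi> lie_homD[OF \<pi>])
    moreover have "?h (a \<odot>\<^bsub>L\<^esub> v) = a \<odot>\<^bsub>?Q\<^esub> ?h v" if "a \<in> carrier K" "v \<in> carrier L" for a v
      using that s h\<phi>[of "a \<odot>\<^bsub>E\<^esub> s v"] by (simp add: \<phi> lie_homD[OF \<pi>])
    moreover have "?h (v \<otimes>\<^bsub>L\<^esub> w) = ?h v \<otimes>\<^bsub>?Q\<^esub> ?h w" if "v \<in> carrier L" "w \<in> carrier L" for v w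
      using that s h\<phi>[of "s v \<otimes>\<^bsub>E\<^esub> s w"] by (simp add: \<phi> lie_homD[OF \<pi>] E.bracket_closed)
    ultimately have "?h \<in> lie_iso K L ?Q" by (simp add: lie_iso_def)
    then show "lie_isomorphic K L ?Q" by (auto simp: lie_isomorphic_def)
  qed
qed

section \<open>Capability of H(1)\<close>

text \<open>
  The filiform Lie algebra of dimension four, with basis \<open>x, y, z, w\<close> and nonzero brackets
  \<open>[x, y] = z\<close> and \<open>[x, z] = w\<close>.  The tuple \<open>(a, b, c, d)\<close> stands for \<open>a x + b y + c z + d w\<close>.  The
  record field \<open>one\<close> has no meaning for a Lie algebra.
\<close>

definition filiform :: "('a, 'b) ring_scheme \<Rightarrow> ('a, 'a \<times> 'a \<times> 'a \<times> 'a) module" where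
  "filiform K =
    \<lparr>carrier = carrier K \<times> carrier K \<times> carrier K \<times> carrier K,
     mult = (\<lambda>(a, b, c, d) (a', b', c', d'). (\<zero>\<^bsub>K\<^esub>, \<zero>\<^bsub>K\<^esub>,
       a \<otimes>\<^bsub>K\<^esub> b' \<ominus>\<^bsub>K\<^esub> b \<otimes>\<^bsub>K\<^esub> a', a \<otimes>\<^bsub>K\<^esub> c' \<ominus>\<^bsub>K\<^esub> c \<otimes>\<^bsub>K\<^esub> a')),
     one = undefined,
     zero = (\<zero>\<^bsub>K\<^esub>, \<zero>\<^bsub>K\<^esub>, \<zero>\<^bsub>K\<^esub>, \<zero>\<^bsub>K\<^esub>),
     add = (\<lambda>(a, b, c, d) (a', b', c', d'). (a \<oplus>\<^bsub>K\<^esub> a', b \<oplus>\<^bsub>K\<^esub> b', c \<oplus>\<^bsub>K\<^esub> c', d \<oplus>\<^bsub>K\<^esub> d')),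
     smult = (\<lambda>t (a, b, c, d). (t \<otimes>\<^bsub>K\<^esub> a, t \<otimes>\<^bsub>K\<^esub> b, t \<otimes>\<^bsub>K\<^esub> c, t \<otimes>\<^bsub>K\<^esub> d))\<rparr>"

lemma filiform_lie_algebra:
  assumes "field K"
  shows "lie_algebra K (filiform K)"
proof -
  interpret K: field K by fact
  note F = filiform_def
  have ag: "abelian_group (filiform K)"
  proof (rule abelian_groupI)
    fix u assume "u \<in> carrier (filiform K)"
    then obtain a b c d where u: "u = (a, b, c, d)" "a \<in> carrier K" "b \<in> carrier K"
      "c \<in> carrier K" "d \<in> carrier K" by (auto simp: F)
    show "\<exists>y\<in>carrier (filiform K). y \<oplus>\<^bsub>filiform K\<^esub> u = \<zero>\<^bsub>filiform K\<^esub>"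
      by (rule bexI[of _ "(\<ominus>\<^bsub>K\<^esub> a, \<ominus>\<^bsub>K\<^esub> b, \<ominus>\<^bsub>K\<^esub> c, \<ominus>\<^bsub>K\<^esub> d)"]) (use u in \<open>auto simp: F K.l_neg\<close>)
  qed (auto simp: F K.a_ac)
  have "module K (filiform K)"
    by (rule moduleI[OF K.is_cring ag]) (auto simp: F K.m_assoc K.l_distr K.r_distr)
  then show ?thesis
    by (intro lie_algebra.intro K.field_axioms lie_algebra_axioms.intro)
      (clarsimp simp: F, (intro conjI; algebra)?)+
qed

lemma filiform_fin_dim:
  assumes "field K"
  shows "fin_dim K (filiform K)"
proof -
  interpret K: field K by fact
  interpret F: lie_algebra K "filiform K" by (rule filiform_lie_algebra[OF assms])
  let ?e = "\<lambda>i j::nat. if i = j then \<one>\<^bsub>K\<^esub> else \<zero>\<^bsub>K\<^esub>"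
  let ?b = "\<lambda>i. (?e i 0, ?e i 1, ?e i 2, ?e i 3)"
  have idx: "{..<4::nat} = {0, 1, 2, 3}" by auto
  show ?thesis
    unfolding fin_dim_def
  proof (intro exI conjI ballI)
    show "?b \<in> {..<4} \<rightarrow> carrier (filiform K)" by (auto simp: filiform_def)
    fix v assume "v \<in> carrier (filiform K)"
    then obtain a b c d where v: "v = (a, b, c, d)" "a \<in> carrier K" "b \<in> carrier K"
      "c \<in> carrier K" "d \<in> carrier K" by (auto simp: filiform_def)
    let ?c = "\<lambda>i::nat. if i = 0 then a else if i = 1 then b else if i = 2 then c else d"
    have mem: "?c i \<odot>\<^bsub>filiform K\<^esub> ?b i \<in> carrier (filiform K)" for i
      using v by (auto simp: filiform_def)
    have sum: "(\<Oplus>\<^bsub>filiform K\<^esub>i\<in>{..<4}. g i) = g 0 \<oplus>\<^bsub>filiform K\<^esub> (g 1 \<oplus>\<^bsub>filiform K\<^esub> (g 2 \<oplus>\<^bsub>filiform K\<^esub> g 3))"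
      if "\<And>i. g i \<in> carrier (filiform K)" for g :: "nat \<Rightarrow> _"
      unfolding idx using that by (simp add: F.L.M.finsum_insert Pi_iff)
    have "v = (\<Oplus>\<^bsub>filiform K\<^esub>i\<in>{..<4}. ?c i \<odot>\<^bsub>filiform K\<^esub> ?b i)"
      unfolding sum[OF mem] using v by (simp add: filiform_def)
    then show "\<exists>c \<in> {..<4} \<rightarrow> carrier K. v = (\<Oplus>\<^bsub>filiform K\<^esub>i\<in>{..<4}. c i \<odot>\<^bsub>filiform K\<^esub> ?b i)"
      using v by (intro bexI[of _ ?c]) auto
  qed
qed

lemma filiform_center:
  assumes "field K"
  shows "lie_center (filiform K) = {(\<zero>\<^bsub>K\<^esub>, \<zero>\<^bsub>K\<^esub>, \<zero>\<^bsub>K\<^esub>, d) | d. d \<in> carrier K}"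
proof -
  interpret K: field K by fact
  have zero: "a = \<zero>\<^bsub>K\<^esub> \<and> b = \<zero>\<^bsub>K\<^esub> \<and> c = \<zero>\<^bsub>K\<^esub>" if "(a, b, c, d) \<in> lie_center (filiform K)" for a b c d
  proof -
    have mem: "a \<in> carrier K" "b \<in> carrier K" "c \<in> carrier K"
      using that by (simp_all add: lie_center_def filiform_def)
    \<comment> \<open>Bracketing with \<open>x\<close> kills \<open>b\<close> and \<open>c\<close>, and bracketing with \<open>y\<close> kills \<open>a\<close>.\<close>
    have "(a, b, c, d) \<otimes>\<^bsub>filiform K\<^esub> (\<one>\<^bsub>K\<^esub>, \<zero>\<^bsub>K\<^esub>, \<zero>\<^bsub>K\<^esub>, \<zero>\<^bsub>K\<^esub>) = \<zero>\<^bsub>filiform K\<^esub>"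
      and "(a, b, c, d) \<otimes>\<^bsub>filiform K\<^esub> (\<zero>\<^bsub>K\<^esub>, \<one>\<^bsub>K\<^esub>, \<zero>\<^bsub>K\<^esub>, \<zero>\<^bsub>K\<^esub>) = \<zero>\<^bsub>filiform K\<^esub>"
      using that unfolding lie_center_def by (auto simp: filiform_def simp del: K.r_null K.r_one)
    then have "\<ominus>\<^bsub>K\<^esub> b = \<zero>\<^bsub>K\<^esub>" "\<ominus>\<^bsub>K\<^esub> c = \<zero>\<^bsub>K\<^esub>" "a = \<zero>\<^bsub>K\<^esub>"
      using mem by (simp_all add: filiform_def K.minus_eq)
    then show ?thesis
      using mem by (metis K.minus_minus K.minus_zero)
  qed
  have "lie_center (filiform K) \<subseteq> {(\<zero>\<^bsub>K\<^esub>, \<zero>\<^bsub>K\<^esub>, \<zero>\<^bsub>K\<^esub>, d) | d. d \<in> carrier K}"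
  proof
    fix v assume v: "v \<in> lie_center (filiform K)"
    obtain a b c d where abcd: "v = (a, b, c, d)" by (cases v)
    have "d \<in> carrier K"
      using v by (simp add: abcd lie_center_def filiform_def)
    with zero[of a b c d] v show "v \<in> {(\<zero>\<^bsub>K\<^esub>, \<zero>\<^bsub>K\<^esub>, \<zero>\<^bsub>K\<^esub>, d) | d. d \<in> carrier K}"
      by (simp add: abcd)
  qed
  moreover have "(\<zero>\<^bsub>K\<^esub>, \<zero>\<^bsub>K\<^esub>, \<zero>\<^bsub>K\<^esub>, d) \<in> lie_center (filiform K)" if "d \<in> carrier K" for d
    using that by (auto simp: lie_center_def filiform_def K.minus_eq)
  ultimately show ?thesis by blast
qed

lemma heisenberg_1_capable:
  assumes "field K"
  shows "capable K (heisenberg K 1)"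
proof -
  interpret K: field K by fact
  interpret F: lie_algebra K "filiform K" by (rule filiform_lie_algebra[OF assms])
  let ?F = "filiform K" and ?H = "heisenberg K 1"
  have idx: "heis_indices (Suc 0) = {HX (Suc 0), HY (Suc 0), HZ}" by (auto simp: heis_indices_def)
  let ?\<phi> = "\<lambda>(a, b, c, d). \<lambda>k\<in>heis_indices 1. case k of HX _ \<Rightarrow> a | HY _ \<Rightarrow> b | HZ \<Rightarrow> c"
  have hom: "?\<phi> \<in> lie_hom K ?F ?H"
    by (auto simp: lie_hom_def filiform_def heisenberg_def idx intro!: restrict_ext split: if_splits)
  have surj: "?\<phi> ` carrier ?F = carrier ?H"
  proof (intro equalityI subsetI)
    fix v assume v: "v \<in> carrier ?H"
    have "v = ?\<phi> (v (HX 1), v (HY 1), v HZ, \<zero>\<^bsub>K\<^esub>)"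
      using v by (intro extensionalityI[of _ "heis_indices 1"])
        (auto simp: heisenberg_def PiE_def idx)
    moreover have "(v (HX 1), v (HY 1), v HZ, \<zero>\<^bsub>K\<^esub>) \<in> carrier ?F"
      using v by (auto simp: heisenberg_def filiform_def)
    ultimately show "v \<in> ?\<phi> ` carrier ?F" by blast
  qed (use lie_homD(1)[OF hom] in blast)
  have "lie_center ?F = {x \<in> carrier ?F. ?\<phi> x = \<zero>\<^bsub>?H\<^esub>}"
  proof -
    have "?\<phi> (a, b, c, d) = \<zero>\<^bsub>?H\<^esub> \<longleftrightarrow> a = \<zero>\<^bsub>K\<^esub> \<and> b = \<zero>\<^bsub>K\<^esub> \<and> c = \<zero>\<^bsub>K\<^esub>" for a b c d
      by (simp add: heisenberg_def idx restrict_def fun_eq_iff) (metis)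
    then show ?thesis
      unfolding filiform_center[OF assms] by (auto simp: filiform_def)
  qed
  with hom surj have "lie_isomorphic K ?H (lie_quotient ?F (lie_center ?F))"
    by (subst lie_isomorphic_quotient_iff[OF F.lie_algebra_axioms
          heisenberg_lie_algebra[OF assms] F.center_lie_ideal]) blast
  then show ?thesis
    by (rule capableI[OF F.lie_algebra_axioms filiform_fin_dim[OF assms]])
qed

section \<open>Non-capability of H(m) for m at least 2\<close>

text \<open>\<open>[y\<^sub>i, v]\<close> and \<open>[v, x\<^sub>i]\<close> read off a coordinate of \<open>v\<close>, up to sign, as a multiple of \<open>z\<close>.\<close>

lemma heisenberg_bracket_basis:
  assumes "field K" "i \<in> {1..m}" "v \<in> carrier (heisenberg K m)"
  shows "heis_basis K m (HY i) \<otimes>\<^bsub>heisenberg K m\<^esub> v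
      = (\<ominus>\<^bsub>K\<^esub> v (HX i)) \<odot>\<^bsub>heisenberg K m\<^esub> heis_basis K m HZ"
    and "v \<otimes>\<^bsub>heisenberg K m\<^esub> heis_basis K m (HX i)
      = (\<ominus>\<^bsub>K\<^esub> v (HY i)) \<odot>\<^bsub>heisenberg K m\<^esub> heis_basis K m HZ"
proof -
  interpret K: field K by fact
  have mem: "v k \<in> carrier K" if "k \<in> heis_indices m" for k
    using assms(3) that by (auto simp: heisenberg_def)
  have sing: "(\<Oplus>\<^bsub>K\<^esub>j\<in>{1..m}. if i = j then \<ominus>\<^bsub>K\<^esub> f j else \<zero>\<^bsub>K\<^esub>) = \<ominus>\<^bsub>K\<^esub> f i"
    if "f \<in> {1..m} \<rightarrow> carrier K" for f
    using that by (intro K.finsum_singleton[OF assms(2)]) auto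
  have "(\<Oplus>\<^bsub>K\<^esub>j\<in>{1..m}. heis_basis K m (HY i) (HX j) \<otimes>\<^bsub>K\<^esub> v (HY j)
      \<ominus>\<^bsub>K\<^esub> heis_basis K m (HY i) (HY j) \<otimes>\<^bsub>K\<^esub> v (HX j))
    = (\<Oplus>\<^bsub>K\<^esub>j\<in>{1..m}. if i = j then \<ominus>\<^bsub>K\<^esub> v (HX j) else \<zero>\<^bsub>K\<^esub>)"
    by (intro K.finsum_cong') (auto simp: heis_basis_def mem K.minus_eq)
  also have "\<dots> = \<ominus>\<^bsub>K\<^esub> v (HX i)" using mem by (intro sing) auto
  finally show "heis_basis K m (HY i) \<otimes>\<^bsub>heisenberg K m\<^esub> v
      = (\<ominus>\<^bsub>K\<^esub> v (HX i)) \<odot>\<^bsub>heisenberg K m\<^esub> heis_basis K m HZ"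
    using mem assms(2) by (auto simp: heisenberg_def heis_basis_def intro!: restrict_ext)
  have "(\<Oplus>\<^bsub>K\<^esub>j\<in>{1..m}. v (HX j) \<otimes>\<^bsub>K\<^esub> heis_basis K m (HX i) (HY j)
      \<ominus>\<^bsub>K\<^esub> v (HY j) \<otimes>\<^bsub>K\<^esub> heis_basis K m (HX i) (HX j))
    = (\<Oplus>\<^bsub>K\<^esub>j\<in>{1..m}. if i = j then \<ominus>\<^bsub>K\<^esub> v (HY j) else \<zero>\<^bsub>K\<^esub>)"
    by (intro K.finsum_cong') (auto simp: heis_basis_def mem K.minus_eq)
  also have "\<dots> = \<ominus>\<^bsub>K\<^esub> v (HY i)" using mem by (intro sing) auto
  finally show "v \<otimes>\<^bsub>heisenberg K m\<^esub> heis_basis K m (HX i)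
      = (\<ominus>\<^bsub>K\<^esub> v (HY i)) \<odot>\<^bsub>heisenberg K m\<^esub> heis_basis K m HZ"
    using mem assms(2) by (auto simp: heisenberg_def heis_basis_def intro!: restrict_ext)
qed

lemma heisenberg_not_capable:
  assumes K: "field K" and m: "m \<ge> 2"
  shows "\<not> capable K (heisenberg K m)"
proof
  let ?H = "heisenberg K m"
  assume "capable K ?H"
  then obtain E :: "('a, nat \<Rightarrow> 'a) module" where E: "lie_algebra K E"
    and iso: "lie_isomorphic K ?H (lie_quotient E (lie_center E))"
    by (auto simp: capable_def)
  interpret K: field K by fact
  interpret E: lie_algebra K E by fact
  interpret H: lie_algebra K ?H by (rule heisenberg_lie_algebra[OF K])
  obtain \<phi> where hom: "\<phi> \<in> lie_hom K E ?H" and surj: "\<phi> ` carrier E = carrier ?H"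
    and ker: "lie_center E = {x \<in> carrier E. \<phi> x = \<zero>\<^bsub>?H\<^esub>}"
    using iso lie_isomorphic_quotient_iff[OF E H.lie_algebra_axioms E.center_lie_ideal] by blast
  note \<phi> = lie_homD[OF hom]
  let ?e = "heis_basis K m"
  have e_mem: "?e k \<in> carrier ?H" for k
    by (auto simp: heis_basis_def heisenberg_def)
  have "\<exists>x \<in> carrier E. \<phi> x = ?e k" for k
    using surj e_mem[of k] by (metis imageE)
  then obtain l where l: "\<And>k. l k \<in> carrier E" "\<And>k. \<phi> (l k) = ?e k" by metis
  let ?w = "l HZ"
  \<comment> \<open>The kernel of \<open>\<phi>\<close> being central, \<open>[x, s]\<close> depends on \<open>s\<close> only through \<open>\<phi> s\<close>.\<close>
  have bracket_lift: "x \<otimes>\<^bsub>E\<^esub> s = a \<odot>\<^bsub>E\<^esub> (x \<otimes>\<^bsub>E\<^esub> t)"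
    if "x \<in> carrier E" "s \<in> carrier E" "t \<in> carrier E" "a \<in> carrier K" "\<phi> s = a \<odot>\<^bsub>?H\<^esub> \<phi> t" for x s t a
  proof -
    let ?c = "s \<oplus>\<^bsub>E\<^esub> (\<ominus>\<^bsub>K\<^esub> a) \<odot>\<^bsub>E\<^esub> t"
    have "\<phi> ?c = \<zero>\<^bsub>?H\<^esub>"
      using that \<phi>(1) by (simp add: \<phi> H.L.smult_l_minus H.L.M.r_neg)
    then have c: "?c \<in> lie_center E" using that ker by simp
    then have "x \<otimes>\<^bsub>E\<^esub> ?c = \<zero>\<^bsub>E\<^esub>"
      using that E.bracket_skew[of x ?c] by (simp add: lie_center_def)
    moreover have "x \<otimes>\<^bsub>E\<^esub> s = x \<otimes>\<^bsub>E\<^esub> (?c \<oplus>\<^bsub>E\<^esub> a \<odot>\<^bsub>E\<^esub> t)"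
      using that by (simp add: E.L.smult_l_minus E.L.M.a_assoc E.L.M.l_neg)
    moreover have "\<dots> = x \<otimes>\<^bsub>E\<^esub> ?c \<oplus>\<^bsub>E\<^esub> a \<odot>\<^bsub>E\<^esub> (x \<otimes>\<^bsub>E\<^esub> t)"
      using that by (subst E.bracket_add_right) (auto simp: E.bracket_smult_right)
    ultimately show ?thesis
      using that by (simp add: E.bracket_closed)
  qed
  \<comment> \<open>\<open>[u, W]\<close> is a combination of \<open>[X\<^sub>i, W]\<close> and \<open>[Y\<^sub>i, W]\<close> with the coordinates of \<open>\<phi> u\<close> as coefficients.\<close>
  have bracket_w_zero: "u \<otimes>\<^bsub>E\<^esub> ?w = \<zero>\<^bsub>E\<^esub>"
    if u: "u \<in> carrier E" and i: "i \<in> {1..m}"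
      and x: "\<phi> u (HX i) = \<zero>\<^bsub>K\<^esub> \<or> l (HX i) \<otimes>\<^bsub>E\<^esub> ?w = \<zero>\<^bsub>E\<^esub>"
      and y: "\<phi> u (HY i) = \<zero>\<^bsub>K\<^esub> \<or> l (HY i) \<otimes>\<^bsub>E\<^esub> ?w = \<zero>\<^bsub>E\<^esub>" for u i
  proof -
    have mem: "\<phi> u (HX i) \<in> carrier K" "\<phi> u (HY i) \<in> carrier K"
      using \<phi>(1)[OF u] i by (auto simp: heisenberg_def)
    have "l (HX i) \<otimes>\<^bsub>E\<^esub> (l (HY i) \<otimes>\<^bsub>E\<^esub> u) = (\<ominus>\<^bsub>K\<^esub> \<phi> u (HX i)) \<odot>\<^bsub>E\<^esub> (l (HX i) \<otimes>\<^bsub>E\<^esub> ?w)"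
      using u i mem l \<phi>(1)[OF u]
      by (intro bracket_lift) (auto simp: E.bracket_closed \<phi>(4) heisenberg_bracket_basis[OF K])
    also have "\<dots> = \<zero>\<^bsub>E\<^esub>" using x mem l by (auto simp: E.bracket_closed)
    finally have 1: "l (HX i) \<otimes>\<^bsub>E\<^esub> (l (HY i) \<otimes>\<^bsub>E\<^esub> u) = \<zero>\<^bsub>E\<^esub>" .
    have "l (HY i) \<otimes>\<^bsub>E\<^esub> (u \<otimes>\<^bsub>E\<^esub> l (HX i)) = (\<ominus>\<^bsub>K\<^esub> \<phi> u (HY i)) \<odot>\<^bsub>E\<^esub> (l (HY i) \<otimes>\<^bsub>E\<^esub> ?w)"
      using u i mem l \<phi>(1)[OF u]
      by (intro bracket_lift) (auto simp: E.bracket_closed \<phi>(4) heisenberg_bracket_basis[OF K])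
    also have "\<dots> = \<zero>\<^bsub>E\<^esub>" using y mem l by (auto simp: E.bracket_closed)
    finally have "l (HY i) \<otimes>\<^bsub>E\<^esub> (u \<otimes>\<^bsub>E\<^esub> l (HX i)) = \<zero>\<^bsub>E\<^esub>" .
    with 1 have 2: "u \<otimes>\<^bsub>E\<^esub> (l (HX i) \<otimes>\<^bsub>E\<^esub> l (HY i)) = \<zero>\<^bsub>E\<^esub>"
      using E.jacobi[of "l (HX i)" "l (HY i)" u] u l by (simp add: E.bracket_closed)
    have "\<phi> ?w = \<one>\<^bsub>K\<^esub> \<odot>\<^bsub>?H\<^esub> \<phi> (l (HX i) \<otimes>\<^bsub>E\<^esub> l (HY i))"
      using i l heisenberg_brackets(1)[OF K i i, of HZ] e_mem by (simp add: \<phi>(4))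
    then have "u \<otimes>\<^bsub>E\<^esub> ?w = \<one>\<^bsub>K\<^esub> \<odot>\<^bsub>E\<^esub> (u \<otimes>\<^bsub>E\<^esub> (l (HX i) \<otimes>\<^bsub>E\<^esub> l (HY i)))"
      using u l by (intro bracket_lift) (auto simp: E.bracket_closed)
    with 2 show ?thesis by simp
  qed
  \<comment> \<open>Here \<open>m \<ge> 2\<close> enters: \<open>x\<^sub>1\<close> and \<open>y\<^sub>1\<close> have zero coordinates at \<open>x\<^sub>2\<close> and \<open>y\<^sub>2\<close>.\<close>
  have first: "l k \<otimes>\<^bsub>E\<^esub> ?w = \<zero>\<^bsub>E\<^esub>" if "k \<in> {HX 1, HY 1}" for k
    by (rule bracket_w_zero[where i = 2]) (use m that in \<open>auto simp: l heis_basis_def\<close>)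
  have "u \<otimes>\<^bsub>E\<^esub> ?w = \<zero>\<^bsub>E\<^esub>" if "u \<in> carrier E" for u
    by (rule bracket_w_zero[where i = 1]) (use m that first in auto)
  then have "?w \<in> lie_center E"
    using l E.bracket_skew[of ?w] by (simp add: lie_center_def)
  then have "?e HZ = \<zero>\<^bsub>?H\<^esub>" using ker l by simp
  then have "?e HZ HZ = \<zero>\<^bsub>?H\<^esub> HZ" by simp
  then show False by (simp add: heis_basis_def heisenberg_def)
qed

theorem theorem3p4:
  fixes K :: "('a, 'b) ring_scheme" and m :: nat
  assumes "field K" and "m \<ge> 1"
  shows "capable K (heisenberg K m) \<longleftrightarrow> m = 1"
  using assms heisenberg_1_capable[OF assms(1)] heisenberg_not_capable[OF assms(1), of m]
  by (cases "m = 1") auto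

end
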